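(* Suppose that $M'$ of the $M$ user equipments (UEs) in the cell ($M'<M$) change their application usage percentages. The transmission overhead of the distributed resource allocation with no rebidding is not larger than the one with rebidding and equals $M'+1$ at minimum.
   Context: A base station (eNB) serves the $M$ UEs of a cell. Each UE runs several applications; its aggregated utility function is the product of its applications' utility functions raised to the powers given by the application usage percentages, so a change of usage percentages changes the aggregated utility. In the distributed algorithm, UEs send bids to the eNB and the eNB answers with a shadow price; this is iterated $k$ times ($k\ge 1$) until optimal rates are achieved. The transmission overhead is the total number of transmissions, where a message from one UE to the eNB, a broadcast of the eNB, and a message from the eNB to an individual UE each count as one transmission. Each UE $i$ has a subscription-dependent weight $\beta_i$. Either (A) $\beta_i$ is available at the UEs, and the eNB broadcasts the shadow price; or (B) $\beta_i$ is available only at the eNB, and the eNB transmits a modified shadow price (the shadow price divided by $\beta_i$) individually to the UEs concerned. With rebidding, the UEs whose aggregated utility is unchanged also bid again: each of the $M'$ UEs with changed usage sends its initial bid; the eNB announces a new shadow price (one broadcast in case (A); $M$ individual messages in case (B)); then, $k$ times, the $M$ UEs each send a new bid and the eNB announces a new shadow price (one broadcast in case (A); $M$ individual messages in case (B)). With no rebidding, the UEs whose aggregated utility is unchanged keep their bids. In case (A), $k$ times, each of the $M'$ UEs with changed usage sends a bid and the eNB broadcasts a new shadow price. In case (B), each of the $M'$ UEs sends an initial bid and the eNB sends each of them a modified shadow price, and then, $k$ times, each of the $M'$ UEs sends a bid and the eNB sends each of them a modified shadow price. *)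

theory Defs
  imports Complex_Main
begin

text \<open>
  The UEs of the cell are numbered \<open>0, \<dots>, M - 1\<close>. A transmission carries its payload: a bid, the
  shadow price, or the shadow price modified for one UE. How bids and prices are computed from the
  utilities is irrelevant for counting transmissions, so a run takes them as arbitrary families:
  \<open>bid n i\<close> is the bid that UE \<open>i\<close> sends, and \<open>price n\<close> the shadow price that the eNB computes,
  in round \<open>n\<close>, where round 0 is the initial exchange that precedes the \<open>k\<close> iterations (if any).
\<close>

datatype transmission =
    Bid nat real      \<comment> \<open>from a UE to the eNB\<close>
  | Broadcast real    \<comment> \<open>from the eNB to all UEs\<close>
  | Unicast nat real  \<comment> \<open>from the eNB to an individual UE\<close>

datatype weight_location =
    Weights_at_UEs
  | Weights_at_eNB

definition changed_UEs ::
  "nat \<Rightarrow> (nat \<Rightarrow> 'app set) \<Rightarrow> (nat \<Rightarrow> 'app \<Rightarrow> real) \<Rightarrow> (nat \<Rightarrow> 'app \<Rightarrow> real) \<Rightarrow> nat list"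
where
  "changed_UEs M apps usage usage' =
     filter (\<lambda>i. \<exists>a\<in>apps i. usage i a \<noteq> usage' i a) [0..<M]"

definition send_bids :: "nat list \<Rightarrow> (nat \<Rightarrow> real) \<Rightarrow> transmission list" where
  "send_bids ues b = map (\<lambda>i. Bid i (b i)) ues"

fun announce_price ::
  "weight_location \<Rightarrow> (nat \<Rightarrow> real) \<Rightarrow> nat list \<Rightarrow> real \<Rightarrow> transmission list"
where
  "announce_price Weights_at_UEs \<beta> ues p = [Broadcast p]"
| "announce_price Weights_at_eNB \<beta> ues p = map (\<lambda>i. Unicast i (p / \<beta> i)) ues"

definition iterations ::
  "weight_location \<Rightarrow> (nat \<Rightarrow> real) \<Rightarrow> nat list \<Rightarrow> (nat \<Rightarrow> nat \<Rightarrow> real) \<Rightarrow> (nat \<Rightarrow> real) \<Rightarrow> nat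
     \<Rightarrow> transmission list"
where
  "iterations loc \<beta> ues bid price k =
     concat (map (\<lambda>n. send_bids ues (bid n) @ announce_price loc \<beta> ues (price n)) [1..<k + 1])"

definition rebidding ::
  "weight_location \<Rightarrow> (nat \<Rightarrow> real) \<Rightarrow> nat \<Rightarrow> nat list \<Rightarrow> (nat \<Rightarrow> nat \<Rightarrow> real) \<Rightarrow> (nat \<Rightarrow> real) \<Rightarrow> nat
     \<Rightarrow> transmission list"
where
  "rebidding loc \<beta> M changed bid price k =
     send_bids changed (bid 0) @ announce_price loc \<beta> [0..<M] (price 0)
     @ iterations loc \<beta> [0..<M] bid price k"

fun no_rebidding ::
  "weight_location \<Rightarrow> (nat \<Rightarrow> real) \<Rightarrow> nat list \<Rightarrow> (nat \<Rightarrow> nat \<Rightarrow> real) \<Rightarrow> (nat \<Rightarrow> real) \<Rightarrow> nat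
     \<Rightarrow> transmission list"
where
  "no_rebidding Weights_at_UEs \<beta> changed bid price k =
     iterations Weights_at_UEs \<beta> changed bid price k"
| "no_rebidding Weights_at_eNB \<beta> changed bid price k =
     send_bids changed (bid 0) @ announce_price Weights_at_eNB \<beta> changed (price 0)
     @ iterations Weights_at_eNB \<beta> changed bid price k"

definition transmission_overhead :: "transmission list \<Rightarrow> nat" where
  "transmission_overhead ts = length ts"

end

theory Submission
  imports Defs
begin

text \<open>Bids and prices do not affect the number of transmissions, so every overhead has a
  closed form. Let \<open>p\<close> be the number of messages per announcement to all
  \<open>M\<close> UEs: 1 in case (A), \<open>M\<close> in case (B). Rebidding costs
  \<open>M' + p + k * (M + p)\<close>; no rebidding costs \<open>k * (M' + 1)\<close> in case (A)
  and \<open>2 * M' * (k + 1)\<close> in case (B). Since \<open>M' \<le> M\<close>, the comparison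
  (\<open>no_rebidding_le_rebidding\<close>) holds term by term. The lower bound
  (\<open>no_rebidding_lower_bound\<close>) is attained in case (A) with a single iteration.\<close>

fun price_messages :: "weight_location \<Rightarrow> nat \<Rightarrow> nat" where
  "price_messages Weights_at_UEs m = 1"
| "price_messages Weights_at_eNB m = m"

lemma length_send_bids [simp]: "length (send_bids ues b) = length ues"
  by (simp add: send_bids_def)

lemma length_announce_price [simp]:
  "length (announce_price loc \<beta> ues p) = price_messages loc (length ues)"
  by (cases loc) simp_all

lemma length_iterations [simp]:
  "length (iterations loc \<beta> ues bid price k) = k * (length ues + price_messages loc (length ues))"
  \<comment> \<open>All rounds have the same length, so the sum is a product. Keeping
    \<open>[1..<k + 1]\<close> folded lets its length simplify to \<open>k\<close>.\<close>
  by (simp add: iterations_def length_concat comp_def sum_list_triv del: upt_Suc)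

lemma overhead_rebidding:
  "transmission_overhead (rebidding loc \<beta> M changed bid price k)
     = length changed + price_messages loc M + k * (M + price_messages loc M)"
  by (simp add: transmission_overhead_def rebidding_def)

lemma overhead_no_rebidding_UEs:
  "transmission_overhead (no_rebidding Weights_at_UEs \<beta> changed bid price k)
     = k * (length changed + 1)"
  by (simp add: transmission_overhead_def)

lemma overhead_no_rebidding_eNB:
  "transmission_overhead (no_rebidding Weights_at_eNB \<beta> changed bid price k)
     = 2 * length changed + k * (2 * length changed)"
  by (simp add: transmission_overhead_def algebra_simps)

text \<open>Otherwise \<open>simp\<close> would unfold \<open>no_rebidding\<close> before the two
  closed forms above could match.\<close>

declare no_rebidding.simps [simp del]

text \<open>The two runs may use different bids and prices, since only the counts matter.\<close>

lemma no_rebidding_le_rebidding: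
  assumes "length changed \<le> M"
  shows "transmission_overhead (no_rebidding loc \<beta> changed bid price k)
           \<le> transmission_overhead (rebidding loc \<beta> M changed bid' price' k)"
proof (cases loc)
  case Weights_at_UEs
  \<comment> \<open>The iterations alone give the bound; the initial exchange of rebidding is
    slack.\<close>
  have "k * (length changed + 1) \<le> k * (M + 1)"
    using assms by (intro mult_le_mono) auto
  then show ?thesis
    unfolding Weights_at_UEs overhead_no_rebidding_UEs overhead_rebidding price_messages.simps
    by linarith
next
  case Weights_at_eNB
  \<comment> \<open>This bounds the nonlinear part; the initial exchanges compare as
    \<open>2 * M' \<le> M' + M\<close>.\<close>
  have "k * (2 * length changed) \<le> k * (M + M)"
    using assms by (intro mult_le_mono) auto
  then show ?thesis
    using assms unfolding Weights_at_eNB overhead_no_rebidding_eNB overhead_rebidding price_messages.simps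
    by linarith
qed

text \<open>In case (A) one iteration already costs \<open>M' + 1\<close>. In case (B) the initial
  exchange alone costs \<open>2 * M'\<close>, which is at least \<open>M' + 1\<close> once
  \<open>M'\<close> is positive; for \<open>M' = 0\<close> the overhead would be 0.\<close>

lemma no_rebidding_lower_bound:
  assumes "1 \<le> k" and "1 \<le> length changed"
  shows "length changed + 1 \<le> transmission_overhead (no_rebidding loc \<beta> changed bid price k)"
proof (cases loc)
  case Weights_at_UEs
  have "1 * (length changed + 1) \<le> k * (length changed + 1)"
    using assms by (intro mult_le_mono) auto
  then show ?thesis
    by (simp add: Weights_at_UEs overhead_no_rebidding_UEs)
next
  case Weights_at_eNB
  then show ?thesis
    using assms by (simp add: Weights_at_eNB overhead_no_rebidding_eNB)
qed

theorem mainTheorem8: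
  fixes M M' :: nat
    and apps :: "nat \<Rightarrow> 'app set"
    and usage usage' :: "nat \<Rightarrow> 'app \<Rightarrow> real"
    and \<beta> :: "nat \<Rightarrow> real"
    and changed :: "nat list"
  defines "changed \<equiv> changed_UEs M apps usage usage'"
  assumes "card (set changed) = M'"
    and "M' < M"
  shows
    "(\<forall>loc bid price bid' price' k. 1 \<le> k \<longrightarrow>
        transmission_overhead (no_rebidding loc \<beta> changed bid price k)
          \<le> transmission_overhead (rebidding loc \<beta> M changed bid' price' k))
     \<and> (1 \<le> M' \<longrightarrow>
        (let overheads = {transmission_overhead (no_rebidding loc \<beta> changed bid price k)
                            | loc bid price k. 1 \<le> k}
         in M' + 1 \<in> overheads \<and> (\<forall>t\<in>overheads. M' + 1 \<le> t)))"
proof -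
  \<comment> \<open>A filtered \<open>[0..<M]\<close> is distinct, so its length is the cardinality
    of its set.\<close>
  have len: "length changed = M'"
    using assms(2) distinct_card[of changed] by (simp add: assms(1) changed_UEs_def)
  \<comment> \<open>The minimum is attained in case (A) with \<open>k = 1\<close>; the zero bids and
    prices are arbitrary choices.\<close>
  have "transmission_overhead
          (no_rebidding Weights_at_UEs \<beta> changed (\<lambda>_ _. 0) (\<lambda>_. 0) 1) = M' + 1"
    by (simp add: overhead_no_rebidding_UEs len)
  then have "\<exists>loc bid price k. M' + 1
      = transmission_overhead (no_rebidding loc \<beta> changed bid price k) \<and> 1 \<le> k"
    by (metis order_refl)
  moreover have "M' + 1 \<le> transmission_overhead (no_rebidding loc \<beta> changed bid price k)"
    if "1 \<le> M'" "1 \<le> k" for loc bid price k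
    using no_rebidding_lower_bound[of k changed] that len by simp
  ultimately show ?thesis
    using no_rebidding_le_rebidding[of changed M] \<open>M' < M\<close> len by (auto simp: Let_def)
qed

end
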